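(* Let $G$ be an $n$-vertex connected graph with minimum degree $\delta$ and let $G^c$ be the complement of $G$. If $q_1(G^c)<2\delta+1$, then $G$ has a fractional perfect matching unless $G\cong H_1\vee H_2$, where $H_1$ is an independent set on $\delta+1$ vertices (the edgeless graph of order $\delta+1$) and $H_2$ is any graph of order $\delta$.
   Context: Graphs are simple and undirected. For a graph $G$, $A(G)$ is its adjacency matrix, $D(G)$ the diagonal matrix of vertex degrees, $Q(G)=D(G)+A(G)$ its signless Laplacian, and $q_1(G)$ the largest eigenvalue of $Q(G)$. The complement $G^c$ has vertex set $V(G)$ and its edges are the pairs of distinct nonadjacent vertices of $G$. For vertex-disjoint graphs $G_1,G_2$, $G_1\vee G_2$ denotes their join (the disjoint union together with all edges between $V(G_1)$ and $V(G_2)$). A fractional matching of $G$ is a function $f:E(G)\to[0,1]$ such that $\sum_{e\in\Gamma(v)}f(e)\le 1$ for each $v\in V(G)$, where $\Gamma(v)$ is the set of edges incident to $v$. A fractional perfect matching of an $n$-vertex graph $G$ is a fractional matching $f$ with $\sum_{e\in E(G)}f(e)=\frac{n}{2}$. *)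

theory Defs
  imports
    "Graph_Theory.Graph_Theory"
    "Jordan_Normal_Form.Spectral_Radius"
begin

text \<open>
  A finite simple undirected graph is a \<^locale>\<open>pair_graph\<close>: a finite vertex set together with a
  symmetric irreflexive set of ordered pairs. Each undirected edge \<open>{u, v}\<close> is thus stored as the
  two arcs \<open>(u, v)\<close> and \<open>(v, u)\<close>; in particular the out-degree is the usual degree.
\<close>

definition edges :: "'a pair_pre_digraph \<Rightarrow> 'a set set" where
  "edges G = {{u, v} | u v. (u, v) \<in> parcs G}"

definition incident_edges :: "'a pair_pre_digraph \<Rightarrow> 'a \<Rightarrow> 'a set set" where
  "incident_edges G v = {e \<in> edges G. v \<in> e}"

definition vertex_degree :: "'a pair_pre_digraph \<Rightarrow> 'a \<Rightarrow> nat" where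
  "vertex_degree G v = out_degree (with_proj G) v"

definition min_degree :: "'a pair_pre_digraph \<Rightarrow> nat" where
  "min_degree G = Min (vertex_degree G ` pverts G)"

definition complement :: "'a pair_pre_digraph \<Rightarrow> 'a pair_pre_digraph" where
  "complement G = \<lparr> pverts = pverts G,
     parcs = {(u, v). u \<in> pverts G \<and> v \<in> pverts G \<and> u \<noteq> v \<and> (u, v) \<notin> parcs G} \<rparr>"

text \<open>Meant only for graphs with disjoint vertex sets.\<close>

definition join :: "'a pair_pre_digraph \<Rightarrow> 'a pair_pre_digraph \<Rightarrow> 'a pair_pre_digraph" where
  "join G H = \<lparr> pverts = pverts G \<union> pverts H,
     parcs = parcs G \<union> parcs H \<union> pverts G \<times> pverts H \<union> pverts H \<times> pverts G \<rparr>"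

definition isomorphic :: "'a pair_pre_digraph \<Rightarrow> 'b pair_pre_digraph \<Rightarrow> bool" where
  "isomorphic G H \<longleftrightarrow> digraph_iso (with_proj G) (with_proj H)"

text \<open>
  The matrices are taken with respect to a list \<open>vs\<close> enumerating the vertices without repetition.
\<close>

definition adjacency_mat :: "'a pair_pre_digraph \<Rightarrow> 'a list \<Rightarrow> real mat" where
  "adjacency_mat G vs = mat (length vs) (length vs)
     (\<lambda>(i, j). if (vs ! i, vs ! j) \<in> parcs G then 1 else 0)"

definition degree_mat :: "'a pair_pre_digraph \<Rightarrow> 'a list \<Rightarrow> real mat" where
  "degree_mat G vs = mat (length vs) (length vs)
     (\<lambda>(i, j). if i = j then real (vertex_degree G (vs ! i)) else 0)"

definition signless_laplacian :: "'a pair_pre_digraph \<Rightarrow> 'a list \<Rightarrow> real mat" where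
  "signless_laplacian G vs = degree_mat G vs + adjacency_mat G vs"

definition vertex_enum :: "'a pair_pre_digraph \<Rightarrow> 'a list" where
  "vertex_enum G = (SOME vs. distinct vs \<and> set vs = pverts G)"

definition q1 :: "'a pair_pre_digraph \<Rightarrow> real" where
  "q1 G = Max (spectrum (signless_laplacian G (vertex_enum G)))"

definition fractional_matching :: "'a pair_pre_digraph \<Rightarrow> ('a set \<Rightarrow> real) \<Rightarrow> bool" where
  "fractional_matching G f \<longleftrightarrow>
     (\<forall>e \<in> edges G. f e \<in> {0..1}) \<and>
     (\<forall>v \<in> pverts G. (\<Sum>e \<in> incident_edges G v. f e) \<le> 1)"

definition fractional_perfect_matching :: "'a pair_pre_digraph \<Rightarrow> ('a set \<Rightarrow> real) \<Rightarrow> bool" where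
  "fractional_perfect_matching G f \<longleftrightarrow>
     fractional_matching G f \<and> (\<Sum>e \<in> edges G. f e) = real (card (pverts G)) / 2"

lemma pair_graph_complement:
  assumes "pair_graph G"
  shows "pair_graph (complement G)"
proof -
  interpret pair_graph G by fact
  have "sym (parcs G)" using pair_sym_arcs by (simp add: symmetric_def)
  moreover have "parcs (complement G) \<subseteq> pverts G \<times> pverts G" by (auto simp: complement_def)
  then have "finite (parcs (complement G))" using pair_finite_verts finite_subset by blast
  ultimately show ?thesis
    by unfold_locales
      (auto simp: complement_def pair_finite_verts symmetric_def sym_def)
qed

lemma vertex_enum:
  assumes "finite (pverts G)"
  shows "distinct (vertex_enum G)" "set (vertex_enum G) = pverts G"
proof -
  have "\<exists>vs. distinct vs \<and> set vs = pverts G" using assms finite_distinct_list by metis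
  then have "distinct (vertex_enum G) \<and> set (vertex_enum G) = pverts G"
    unfolding vertex_enum_def by (rule someI_ex)
  then show "distinct (vertex_enum G)" "set (vertex_enum G) = pverts G" by auto
qed

text \<open>
  The spectrum does not depend on the enumeration: its elements are the \<open>k\<close> for which the
  signless Laplacian, as an operator on functions on the vertices, has a nonzero eigenfunction.
\<close>

lemma eigenvalue_signless_laplacian_iff:
  assumes "distinct vs"
  shows "eigenvalue (signless_laplacian G vs) k \<longleftrightarrow>
    (\<exists>x. (\<exists>v \<in> set vs. x v \<noteq> 0) \<and>
      (\<forall>u \<in> set vs. real (vertex_degree G u) * x u
         + (\<Sum>v \<in> set vs. if (u, v) \<in> parcs G then x v else 0) = k * x u))"
    (is "?L \<longleftrightarrow> ?R")
proof -
  let ?n = "length vs"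
  let ?Q = "signless_laplacian G vs"
  have dim: "dim_row ?Q = ?n" "dim_col ?Q = ?n"
    by (simp_all add: signless_laplacian_def adjacency_mat_def degree_mat_def)
  have bij: "bij_betw (\<lambda>i. vs ! i) {0..<?n} (set vs)"
    using bij_betw_nth[OF assms] by (simp add: atLeast0LessThan)
  have entry: "(?Q *\<^sub>v w) $ i = real (vertex_degree G (vs ! i)) * w $ i
      + (\<Sum>j \<in> {0..<?n}. if (vs ! i, vs ! j) \<in> parcs G then w $ j else 0)"
    if w: "w \<in> carrier_vec ?n" and i: "i < ?n" for w i
  proof -
    have "(?Q *\<^sub>v w) $ i = (\<Sum>j \<in> {0..<?n}. ?Q $$ (i, j) * w $ j)"
      using w i dim by (auto simp: scalar_prod_def intro!: sum.cong)
    also have "\<dots> = (\<Sum>j \<in> {0..<?n}. (if i = j then real (vertex_degree G (vs ! i)) * w $ j else 0)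
        + (if (vs ! i, vs ! j) \<in> parcs G then w $ j else 0))"
      using i by (intro sum.cong)
        (auto simp: signless_laplacian_def adjacency_mat_def degree_mat_def algebra_simps)
    finally show ?thesis using i by (simp add: sum.distrib)
  qed
  show ?thesis
  proof
    assume ?L
    then obtain w where w: "w \<in> carrier_vec ?n" "w \<noteq> 0\<^sub>v ?n" "?Q *\<^sub>v w = k \<cdot>\<^sub>v w"
      by (auto simp: eigenvalue_def eigenvector_def dim)
    define x where "x v = w $ (the_inv_into {0..<?n} (\<lambda>i. vs ! i) v)" for v
    have x: "x (vs ! i) = w $ i" if "i < ?n" for i
      using that bij by (simp add: x_def the_inv_into_f_f bij_betw_def)
    have "\<exists>i < ?n. w $ i \<noteq> 0"
      using w(1,2) by (metis carrier_vecD eq_vecI index_zero_vec)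
    then have "\<exists>v \<in> set vs. x v \<noteq> 0" using x by (metis nth_mem)
    moreover have "real (vertex_degree G u) * x u
        + (\<Sum>v \<in> set vs. if (u, v) \<in> parcs G then x v else 0) = k * x u" if u: "u \<in> set vs" for u
    proof -
      obtain i where i: "i < ?n" "u = vs ! i" using u by (metis in_set_conv_nth)
      have "(\<Sum>v \<in> set vs. if (u, v) \<in> parcs G then x v else 0)
          = (\<Sum>j \<in> {0..<?n}. if (u, vs ! j) \<in> parcs G then w $ j else 0)"
        by (subst sum.reindex_bij_betw[OF bij, symmetric]) (auto simp: x intro!: sum.cong)
      moreover have "(?Q *\<^sub>v w) $ i = k * w $ i" using w i by simp
      ultimately show ?thesis using entry[OF w(1) i(1)] i x by simp
    qed
    ultimately show ?R by blast
  next
    assume ?R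
    then obtain x where x: "\<exists>v \<in> set vs. x v \<noteq> 0"
      "\<And>u. u \<in> set vs \<Longrightarrow> real (vertex_degree G u) * x u
         + (\<Sum>v \<in> set vs. if (u, v) \<in> parcs G then x v else 0) = k * x u" by blast
    define w where "w = vec ?n (\<lambda>i. x (vs ! i))"
    have w: "w \<in> carrier_vec ?n" by (simp add: w_def)
    have "w \<noteq> 0\<^sub>v ?n" using x(1) by (metis in_set_conv_nth index_vec index_zero_vec(1) w_def)
    moreover have "?Q *\<^sub>v w = k \<cdot>\<^sub>v w"
    proof (rule eq_vecI)
      fix i assume "i < dim_vec (k \<cdot>\<^sub>v w)"
      then have i: "i < ?n" by (simp add: w_def)
      have "(\<Sum>v \<in> set vs. if (vs ! i, v) \<in> parcs G then x v else 0)
          = (\<Sum>j \<in> {0..<?n}. if (vs ! i, vs ! j) \<in> parcs G then w $ j else 0)"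
        by (subst sum.reindex_bij_betw[OF bij, symmetric]) (auto simp: w_def intro!: sum.cong)
      then show "(?Q *\<^sub>v w) $ i = (k \<cdot>\<^sub>v w) $ i"
        using entry[OF w i] x(2)[of "vs ! i"] i by (simp add: w_def)
    qed (simp add: dim w_def)
    ultimately show ?L using w by (auto simp: eigenvalue_def eigenvector_def dim)
  qed
qed

lemma q1_eq:
  assumes "distinct vs" "set vs = pverts G"
  shows "q1 G = Max (spectrum (signless_laplacian G vs))"
proof -
  have "finite (pverts G)" using assms(2) by (metis List.finite_set)
  note e = vertex_enum[OF this]
  have "eigenvalue (signless_laplacian G (vertex_enum G)) k = eigenvalue (signless_laplacian G vs) k" for k
    by (simp add: eigenvalue_signless_laplacian_iff[OF assms(1)]
        eigenvalue_signless_laplacian_iff[OF e(1)] e(2) assms(2))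
  then have "eigenvalue (signless_laplacian G (vertex_enum G)) = eigenvalue (signless_laplacian G vs)"
    by (rule ext)
  then show ?thesis by (simp add: q1_def spectrum_def)
qed

end

theory Submission
  imports "HOL-Analysis.Function_Topology" Defs
begin

text \<open>
  If every independent set \<open>T\<close> satisfies \<open>|T| \<le> |N(T)|\<close>, then so does every vertex set, and Hall's
  theorem yields an injection sending each vertex \<open>v\<close> to a neighbour \<open>s v\<close>; giving weight \<open>1/2\<close> to
  each edge \<open>{v, s v}\<close> is a fractional perfect matching. Otherwise some independent \<open>T\<close> has
  \<open>|T| > |N(T)| \<ge> \<delta>\<close>. An independent set of size \<open>t\<close> is a clique of the complement, and the Rayleigh
  quotient of its indicator vector gives \<open>q\<^sub>1 \<ge> 2 (t - 1)\<close>, so independent sets have at most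
  \<open>\<delta> + 1\<close> vertices. Hence \<open>|T| = \<delta> + 1\<close> and \<open>|N(T)| = \<delta>\<close>, every vertex of \<open>T\<close> is adjacent to all
  of \<open>N(T)\<close>, and no vertex lies outside \<open>T \<union> N(T)\<close>, since it could be added to \<open>T\<close>.
\<close>

section \<open>Hall's marriage theorem\<close>

text \<open>Strong induction on \<open>A\<close>. If some nonempty proper subset \<open>X\<close> is
  tight, having no more than \<open>card X\<close> neighbours, match \<open>X\<close> and
  \<open>A - X\<close> separately. Otherwise every such subset has a spare neighbour, so one pair
  can be fixed at will and removed.\<close>

theorem Hall_marriage:
  assumes "finite A" and "\<And>a. a \<in> A \<Longrightarrow> finite (N a)"
    and "\<And>X. X \<subseteq> A \<Longrightarrow> card X \<le> card (\<Union>(N ` X))"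
  shows "\<exists>s. inj_on s A \<and> (\<forall>a \<in> A. s a \<in> N a)"
  using assms
proof (induction A arbitrary: N rule: finite_psubset_induct)
  case (psubset A)
  note fin = psubset.prems(1) and hall = psubset.prems(2)
  have finU: "finite (\<Union>(N ` X))" if "X \<subseteq> A" for X
    using that psubset.hyps fin by (meson finite_UN finite_subset subsetD)
  consider (empty) "A = {}"
    | (tight) X where "X \<subset> A" "X \<noteq> {}" "card (\<Union>(N ` X)) \<le> card X"
    | (slack) "A \<noteq> {}" "\<And>X. X \<subset> A \<Longrightarrow> X \<noteq> {} \<Longrightarrow> card X < card (\<Union>(N ` X))"
    by (meson not_le)
  then show ?case
  proof cases
    case empty
    then show ?thesis by simp
  next
    case (tight X)
    \<comment> \<open>\<open>A - X\<close> may use only neighbours that \<open>X\<close> cannot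
      reach, so the two injections have disjoint images. Hall's condition for \<open>Y\<close>
      survives: apply it to \<open>X \<union> Y\<close> and cancel the tight
      \<open>X\<close>.\<close>
    let ?N = "\<lambda>a. N a - \<Union>(N ` X)"
    have finX: "finite X" using tight psubset.hyps finite_subset by auto
    have "\<exists>s. inj_on s X \<and> (\<forall>a \<in> X. s a \<in> N a)"
      using tight fin hall by (intro psubset.IH) (simp_all add: psubset_eq subset_iff)
    then obtain s where s: "inj_on s X" "\<And>a. a \<in> X \<Longrightarrow> s a \<in> N a" by blast
    have "card Y \<le> card (\<Union>(?N ` Y))" if Y: "Y \<subseteq> A - X" for Y
    proof -
      have finY: "finite Y" using Y psubset.hyps finite_subset by auto
      have "card X + card Y = card (X \<union> Y)"
        using Y finX finY by (subst card_Un_disjoint) auto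
      also have "\<dots> \<le> card (\<Union>(N ` (X \<union> Y)))"
        using Y tight by (intro hall) auto
      also have "\<Union>(N ` (X \<union> Y)) = \<Union>(N ` X) \<union> \<Union>(?N ` Y)" by auto
      also have "card \<dots> \<le> card (\<Union>(N ` X)) + card (\<Union>(?N ` Y))" by (rule card_Un_le)
      finally show ?thesis using tight by linarith
    qed
    then have "\<exists>s. inj_on s (A - X) \<and> (\<forall>a \<in> A - X. s a \<in> ?N a)"
      using tight by (intro psubset.IH) (auto intro: fin)
    then obtain t where t: "inj_on t (A - X)" "\<And>a. a \<in> A - X \<Longrightarrow> t a \<in> ?N a" by blast
    let ?r = "\<lambda>a. if a \<in> X then s a else t a"
    have "s a \<noteq> t b" if "a \<in> X" "b \<in> A - X" for a b
      using s(2)[of a] t(2)[of b] that by auto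
    then have "inj_on ?r A" using s(1) t(1) unfolding inj_on_def by (smt (verit) Diff_iff)
    moreover have "?r a \<in> N a" if "a \<in> A" for a using s(2) t(2)[of a] that by auto
    ultimately show ?thesis by blast
  next
    case slack
    then obtain a where a: "a \<in> A" by blast
    with hall[of "{a}"] fin[of a] obtain b where b: "b \<in> N a" by fastforce
    let ?N = "\<lambda>x. N x - {b}"
    have "card X \<le> card (\<Union>(?N ` X))" if X: "X \<subseteq> A - {a}" for X
    proof (cases "X = {}")
      case False
      \<comment> \<open>\<open>X\<close> misses \<open>a\<close>, hence is a proper subset and has a
        spare neighbour to pay for the deleted \<open>b\<close>.\<close>
      then have "card X < card (\<Union>(N ` X))" using X a by (intro slack(2)) auto
      also have "card (\<Union>(N ` X)) \<le> card (insert b (\<Union>(?N ` X)))"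
        using finU[of X] X by (intro card_mono) (auto intro: finite_subset[rotated])
      also have "\<dots> \<le> Suc (card (\<Union>(?N ` X)))" by (rule card_insert_le_m1) simp_all
      finally show ?thesis by simp
    qed simp
    then have "\<exists>s. inj_on s (A - {a}) \<and> (\<forall>x \<in> A - {a}. s x \<in> ?N x)"
      using a by (intro psubset.IH) (auto intro: fin)
    then obtain s where s: "inj_on s (A - {a})" "\<And>x. x \<in> A - {a} \<Longrightarrow> s x \<in> ?N x" by blast
    have "inj_on (s(a := b)) A" using s by (fastforce simp: inj_on_def)
    moreover have "(s(a := b)) x \<in> N x" if "x \<in> A" for x using s(2)[of x] b that by auto
    ultimately show ?thesis by blast
  qed
qed

section \<open>Rayleigh quotients of symmetric matrices\<close>

text \<open>A maximiser of the quadratic form on the unit sphere is an eigenvector.\<close>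

lemma symmetric_eigenvalue_ge_Rayleigh:
  fixes M :: "'a \<Rightarrow> 'a \<Rightarrow> real" and x :: "'a \<Rightarrow> real"
  assumes "finite V" and sym: "\<And>u v. M u v = M v u"
    and "\<exists>v \<in> V. x v \<noteq> 0"
    and c: "c * (\<Sum>v \<in> V. (x v)\<^sup>2) \<le> (\<Sum>u \<in> V. \<Sum>v \<in> V. M u v * x u * x v)"
  shows "\<exists>k \<ge> c. \<exists>y. (\<exists>v \<in> V. y v \<noteq> 0) \<and> (\<forall>u \<in> V. (\<Sum>v \<in> V. M u v * y v) = k * y u)"
proof -
  define q where "q y = (\<Sum>u \<in> V. \<Sum>v \<in> V. M u v * y u * y v)" for y
  define l where "l y = (\<Sum>v \<in> V. (y v)\<^sup>2)" for y :: "'a \<Rightarrow> real"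
  \<comment> \<open>The unit sphere, with coordinates outside \<open>V\<close> pinned to 0 so that
    it is compact in the full function space. The box excludes no unit vector and makes compactness
    an instance of Tychonoff's theorem.\<close>
  define S where "S = {y. l y = 1} \<inter> (\<Pi>\<^sub>E v\<in>UNIV. if v \<in> V then {-1..1} else {0})"
  have q_cong: "q y = q z" "l y = l z" if "\<And>v. v \<in> V \<Longrightarrow> y v = z v" for y z
    using that by (simp_all add: q_def l_def)
  have q_scale: "q (\<lambda>v. t * y v) = t\<^sup>2 * q y" and l_scale: "l (\<lambda>v. t * y v) = t\<^sup>2 * l y" for t y
    by (simp_all add: q_def l_def sum_distrib_left power2_eq_square algebra_simps)
  have l_pos: "0 < l y" if "\<exists>v \<in> V. y v \<noteq> 0" for y
  proof -
    have "l y \<noteq> 0" using that \<open>finite V\<close> by (auto simp: l_def sum_nonneg_eq_0_iff)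
    moreover have "0 \<le> l y" by (simp add: l_def sum_nonneg)
    ultimately show ?thesis by simp
  qed
  have normalise: "\<exists>z \<in> S. q y = l y * q z" if y: "\<exists>v \<in> V. y v \<noteq> 0" for y
  proof -
    define t where "t = 1 / sqrt (l y)"
    have t: "t\<^sup>2 * l y = 1" using l_pos[OF y] by (simp add: t_def power_divide)
    define z where "z v = (if v \<in> V then t * y v else 0)" for v
    have z: "l z = 1" "q z = t\<^sup>2 * q y"
      using q_cong[of z "\<lambda>v. t * y v"] q_scale[of t y] l_scale[of t y] t by (simp_all add: z_def)
    have "(z v)\<^sup>2 \<le> 1" if "v \<in> V" for v
      using member_le_sum[of v V "\<lambda>v. (z v)\<^sup>2"] that \<open>finite V\<close> z(1) by (simp add: l_def)
    then have "z v \<in> {-1..1}" if "v \<in> V" for v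
      using that by (simp add: abs_square_le_1 abs_le_iff)
    then have "z \<in> S" using z by (simp add: S_def PiE_iff z_def)
    moreover have "q y = l y * q z" using t z(2) by (simp add: mult.assoc[symmetric] mult.commute)
    ultimately show ?thesis by blast
  qed
  have cont: "continuous_on UNIV q" "continuous_on UNIV l"
    unfolding q_def l_def by (intro continuous_intros; simp)+
  have "compactin (product_topology (\<lambda>_. euclidean) UNIV)
      (\<Pi>\<^sub>E v\<in>UNIV. if v \<in> V then {-1..1::real} else {0})"
    by (auto simp: compactin_PiE)
  then have "compact (\<Pi>\<^sub>E v\<in>UNIV. if v \<in> V then {-1..1::real} else {0})"
    by (simp add: euclidean_product_topology)
  moreover have "closed {y. l y = 1}"
    using cont(2) by (intro closed_Collect_eq) auto
  ultimately have "compact S" unfolding S_def by (rule closed_Int_compact[rotated])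
  \<comment> \<open>\<open>x'\<close> shows that \<open>S\<close> is nonempty and later transfers
    the bound \<open>c\<close> from \<open>x\<close> to the maximum \<open>k\<close>.\<close>
  moreover obtain x' where x': "x' \<in> S" "q x = l x * q x'" using normalise assms(3) by blast
  ultimately obtain y where y: "y \<in> S" and max: "\<And>z. z \<in> S \<Longrightarrow> q z \<le> q y"
    using continuous_attains_sup[of S q] continuous_on_subset[OF cont(1)] by blast
  define k where "k = q y"
  have ly: "l y = 1" using y by (simp add: S_def)
  have "\<exists>v \<in> V. y v \<noteq> 0"
  proof (rule ccontr)
    assume "\<not> (\<exists>v \<in> V. y v \<noteq> 0)"
    then show False using ly by (simp add: l_def)
  qed
  have "c * l x \<le> q x" using c by (simp add: q_def l_def)
  also have "\<dots> = q x' * l x" using x'(2) by simp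
  also have "\<dots> \<le> k * l x"
    using max[OF x'(1)] l_pos[OF assms(3)] by (simp add: k_def)
  finally have "c \<le> k" using l_pos[OF assms(3)] by simp
  \<comment> \<open>So \<open>k * l z - q z\<close> is nonnegative everywhere and vanishes at
    \<open>y\<close>; its first-order change there must be zero in each coordinate
    direction.\<close>
  have bound: "q z \<le> k * l z" for z
  proof (cases "\<exists>v \<in> V. z v \<noteq> 0")
    case True
    then obtain w where "w \<in> S" "q z = l z * q w" using normalise by blast
    then show ?thesis using max[of w] l_pos[OF True] by (simp add: k_def mult.commute)
  qed (simp add: q_def l_def)
  have "(\<Sum>v \<in> V. M u v * y v) = k * y u" if u: "u \<in> V" for u
  proof (rule ccontr)
    let ?e = "\<lambda>v. if v = u then 1 else 0 :: real"
    \<comment> \<open>\<open>2 * b\<close> is the derivative of \<open>q - k * l\<close> at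
      \<open>y\<close> in the direction of coordinate \<open>u\<close>.\<close>
    define b where "b = (\<Sum>v \<in> V. M u v * y v) - k * y u"
    assume "(\<Sum>v \<in> V. M u v * y v) \<noteq> k * y u"
    then have "b \<noteq> 0" by (simp add: b_def)
    have b_le: "2 * t * b \<le> t\<^sup>2 * (k - M u u)" for t
    proof -
      let ?z = "\<lambda>v. y v + t * ?e v"
      have "l ?z = (\<Sum>v \<in> V. (y v)\<^sup>2 + (if v = u then 2 * t * y v + t\<^sup>2 else 0))"
        unfolding l_def by (intro sum.cong) (auto simp: power2_eq_square algebra_simps)
      then have lz: "l ?z = 1 + 2 * t * y u + t\<^sup>2"
        using ly u \<open>finite V\<close> by (simp add: sum.distrib l_def)
      \<comment> \<open>Only column \<open>u\<close> and row \<open>u\<close> feel the perturbation.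
        After summing over \<open>w\<close>, their linear terms coincide by symmetry of
        \<open>M\<close>.\<close>
      have "(\<Sum>v \<in> V. M w v * ?z w * ?z v) = (\<Sum>v \<in> V. M w v * y w * y v)
          + t * M w u * y w + (if w = u then t * (\<Sum>v \<in> V. M u v * y v) + t\<^sup>2 * M u u else 0)"
        if "w \<in> V" for w
      proof -
        have "(\<Sum>v \<in> V. M w v * ?z w * ?z v) = (\<Sum>v \<in> V. M w v * y w * y v
          + (if w = u then t * (M u v * y v) else 0)
          + (if v = u then t * M w u * y w + (if w = u then t\<^sup>2 * M u u else 0) else 0))"
          by (intro sum.cong) (auto simp: power2_eq_square algebra_simps)
        then show ?thesis using u \<open>finite V\<close> by (simp add: sum.distrib sum_distrib_left)
      qed
      then have "q ?z = q y + (\<Sum>w \<in> V. t * M w u * y w)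
          + (t * (\<Sum>v \<in> V. M u v * y v) + t\<^sup>2 * M u u)"
        using u \<open>finite V\<close> by (simp add: q_def sum.distrib)
      also have "(\<Sum>w \<in> V. t * M w u * y w) = t * (\<Sum>v \<in> V. M u v * y v)"
        using sym by (simp add: sum_distrib_left mult.assoc)
      finally have "q ?z = k + 2 * t * (b + k * y u) + t\<^sup>2 * M u u"
        by (simp add: b_def k_def)
      with bound[of ?z] lz show ?thesis by (simp add: algebra_simps)
    qed
    \<comment> \<open>\<open>d\<close> is positive and at least \<open>k - M u u\<close>, so with
      \<open>t = b / d\<close> the quadratic term is at most \<open>b^2 / d\<close>, too small for
      the linear term \<open>2 * b^2 / d\<close> unless \<open>b = 0\<close>.\<close>
    define d where "d = \<bar>k - M u u\<bar> + 1"
    have "2 * b\<^sup>2 / d \<le> b\<^sup>2 / d\<^sup>2 * (k - M u u)"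
      using b_le[of "b / d"] by (simp add: power2_eq_square)
    also have "\<dots> \<le> b\<^sup>2 / d\<^sup>2 * d" by (intro mult_left_mono) (auto simp: d_def)
    also have "\<dots> = b\<^sup>2 / d" by (simp add: power2_eq_square)
    finally have "b\<^sup>2 / d \<le> 0" by simp
    moreover have "b\<^sup>2 / d > 0" using \<open>b \<noteq> 0\<close> by (simp add: d_def)
    ultimately show False by simp
  qed
  with \<open>c \<le> k\<close> \<open>\<exists>v \<in> V. y v \<noteq> 0\<close> show ?thesis by blast
qed

section \<open>Cliques and the largest signless Laplacian eigenvalue\<close>

lemma vertex_degree_eq_card: "vertex_degree G v = card {u. (v, u) \<in> parcs G}"
proof -
  have "out_arcs (with_proj G) v = Pair v ` {u. (v, u) \<in> parcs G}"
    by (auto simp: out_arcs_def)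
  then show ?thesis by (simp add: vertex_degree_def out_degree_def card_image inj_on_def)
qed

text \<open>The test vector is the indicator of \<open>T\<close>. Each row of \<open>T\<close>
  contributes at least \<open>card T - 1\<close> on the diagonal, because a clique vertex has that
  many neighbours inside \<open>T\<close>, and exactly \<open>card T - 1\<close> off it.\<close>

lemma q1_ge_clique:
  assumes "pair_graph G" and "T \<subseteq> pverts G" "T \<noteq> {}"
    and clique: "\<And>u v. u \<in> T \<Longrightarrow> v \<in> T \<Longrightarrow> u \<noteq> v \<Longrightarrow> (u, v) \<in> parcs G"
  shows "2 * (real (card T) - 1) \<le> q1 G"
proof -
  interpret pair_graph G by fact
  let ?V = "pverts G"
  have sym: "(u, v) \<in> parcs G \<longleftrightarrow> (v, u) \<in> parcs G" for u v
    using pair_sym_arcs by (auto simp: symmetric_def sym_def)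
  note finV = pair_finite_verts
  have finT: "finite T" using assms(2) finV finite_subset by blast
  have loopfree: "(u, u) \<notin> parcs G" for u using pair_no_loops by fastforce
  \<comment> \<open>The signless Laplacian indexed by vertices instead of positions in an
    enumeration, as the Rayleigh lemma expects.\<close>
  define M where "M u v = (if u = v then real (vertex_degree G u) else if (u, v) \<in> parcs G then 1 else 0)"
    for u v
  define x where "x v = (if v \<in> T then 1 else 0 :: real)" for v
  have row: "(\<Sum>v \<in> ?V. M u v * y v)
      = real (vertex_degree G u) * y u + (\<Sum>v \<in> ?V. if (u, v) \<in> parcs G then y v else 0)"
    if u: "u \<in> ?V" for u y
  proof -
    have "(\<Sum>v \<in> ?V. M u v * y v) = (\<Sum>v \<in> ?V. (if u = v then real (vertex_degree G u) * y v else 0)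
        + (if (u, v) \<in> parcs G then y v else 0))"
      by (intro sum.cong) (auto simp: M_def loopfree)
    then show ?thesis using u finV by (simp add: sum.distrib)
  qed
  have deg: "card T - 1 \<le> vertex_degree G u" if "u \<in> T" for u
  proof -
    have "card (T - {u}) \<le> card {v. (u, v) \<in> parcs G}"
      using that clique finV wellformed'
      by (intro card_mono) (auto intro: finite_subset[of _ ?V])
    then show ?thesis using that finT by (simp add: vertex_degree_eq_card)
  qed
  have card_pos: "card T \<ge> 1" using assms(3) finT by (simp add: Suc_le_eq card_gt_0_iff)
  have inner: "2 * (real (card T) - 1) \<le> (\<Sum>v \<in> ?V. M u v * x u * x v)" if u: "u \<in> T" for u
  proof -
    have "(\<Sum>v \<in> ?V. M u v * x u * x v) = (\<Sum>v \<in> T. M u v)"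
      using assms(2) finV u by (intro sum.mono_neutral_cong_right) (auto simp: x_def)
    also have "\<dots> = M u u + (\<Sum>v \<in> T - {u}. M u v)" using u finT by (simp add: sum.remove)
    also have "(\<Sum>v \<in> T - {u}. M u v) = (\<Sum>v \<in> T - {u}. 1)"
      using clique u by (intro sum.cong) (auto simp: M_def)
    also have "\<dots> = real (card T) - 1" using u finT card_pos by (simp add: of_nat_diff)
    finally show ?thesis using deg[OF u] card_pos by (simp add: M_def)
  qed
  have "2 * (real (card T) - 1) * (\<Sum>v \<in> ?V. (x v)\<^sup>2) = 2 * (real (card T) - 1) * (\<Sum>v \<in> T. 1)"
    using assms(2) finV by (intro arg_cong2[where f="(*)"] refl sum.mono_neutral_cong_right) (auto simp: x_def)
  also have "\<dots> = (\<Sum>u \<in> T. 2 * (real (card T) - 1))" by simp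
  also have "\<dots> \<le> (\<Sum>u \<in> T. \<Sum>v \<in> ?V. M u v * x u * x v)" by (intro sum_mono inner)
  also have "\<dots> = (\<Sum>u \<in> ?V. \<Sum>v \<in> ?V. M u v * x u * x v)"
    using assms(2) finV by (intro sum.mono_neutral_cong_left) (auto simp: x_def)
  finally have Rayleigh: "2 * (real (card T) - 1) * (\<Sum>v \<in> ?V. (x v)\<^sup>2)
      \<le> (\<Sum>u \<in> ?V. \<Sum>v \<in> ?V. M u v * x u * x v)" .
  have "\<exists>k \<ge> 2 * (real (card T) - 1). \<exists>y. (\<exists>v \<in> ?V. y v \<noteq> 0) \<and>
      (\<forall>u \<in> ?V. (\<Sum>v \<in> ?V. M u v * y v) = k * y u)"
    using assms(2,3) finV sym Rayleigh
    by (intro symmetric_eigenvalue_ge_Rayleigh[of _ _ x]) (auto simp: M_def x_def)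
  then obtain k y where k: "k \<ge> 2 * (real (card T) - 1)" and "\<exists>v \<in> ?V. y v \<noteq> 0"
    and "\<And>u. u \<in> ?V \<Longrightarrow> (\<Sum>v \<in> ?V. M u v * y v) = k * y u" by blast
  then have "eigenvalue (signless_laplacian G (vertex_enum G)) k"
    unfolding eigenvalue_signless_laplacian_iff[OF vertex_enum(1)[OF finV]] vertex_enum(2)[OF finV]
    by (intro exI[of _ y]) (simp add: row[symmetric])
  \<comment> \<open>\<open>q1\<close> is a \<open>Max\<close>, so bounding an eigenvalue by it
    relies on finiteness of the spectrum.\<close>
  moreover have "finite (spectrum (signless_laplacian G (vertex_enum G)))"
    by (rule card_finite_spectrum(1)[of _ "length (vertex_enum G)"])
      (simp add: signless_laplacian_def degree_mat_def adjacency_mat_def)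
  ultimately have "k \<le> q1 G" unfolding q1_def by (intro Max_ge) (auto simp: spectrum_def)
  with k show ?thesis by simp
qed

section \<open>Fractional perfect matchings from expansion of independent sets\<close>

text \<open>Every vertex \<open>v\<close> puts weight 1/2 on the edge \<open>{v, s v}\<close>. An
  edge can be chosen only by its two ends, and the edges at a vertex only by that vertex and its at
  most one preimage under \<open>s\<close>, so no capacity is exceeded.\<close>

lemma fractional_perfect_matching_if_injection:
  assumes "pair_graph G"
    and inj: "inj_on s (pverts G)" and s: "\<And>v. v \<in> pverts G \<Longrightarrow> (v, s v) \<in> parcs G"
  shows "\<exists>f. fractional_perfect_matching G f"
proof -
  interpret pair_graph G by fact
  let ?V = "pverts G"
  note finV = pair_finite_verts
  \<comment> \<open>\<open>F e\<close> collects the vertices that choose \<open>e\<close>. An edge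
    whose ends are swapped by \<open>s\<close> is chosen twice and gets weight 1.\<close>
  define F where "F e = {u \<in> ?V. {u, s u} = e}" for e
  define f where "f e = real (card (F e)) / 2" for e
  have finF: "finite (F e)" for e using finV by (simp add: F_def)
  have edge: "{u, s u} \<in> edges G" if "u \<in> ?V" for u using s[OF that] by (auto simp: edges_def)
  have finE: "finite (edges G)"
  proof (rule finite_subset)
    show "edges G \<subseteq> (\<lambda>(u, v). {u, v}) ` parcs G" by (auto simp: edges_def)
  qed (use pair_finite_arcs in simp)
  \<comment> \<open>Each vertex chooses just one edge, so the sets \<open>F e\<close> are disjoint
    and their cardinalities add up.\<close>
  have sum_F: "(\<Sum>e \<in> E. f e) = real (card {u \<in> ?V. {u, s u} \<in> E}) / 2" if "E \<subseteq> edges G" for E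
  proof -
    have finE': "finite E" using that finE finite_subset by blast
    have "{u \<in> ?V. {u, s u} \<in> E} = (\<Union>e \<in> E. F e)" by (auto simp: F_def)
    then have "card {u \<in> ?V. {u, s u} \<in> E} = (\<Sum>e \<in> E. card (F e))"
      using finE' finF by (simp only:) (rule card_UN_disjoint, auto simp: F_def)
    then show ?thesis by (simp add: f_def sum_divide_distrib)
  qed
  have "f e \<le> 1" if "e \<in> edges G" for e
  proof -
    obtain u v where e: "e = {u, v}" using \<open>e \<in> edges G\<close> unfolding edges_def by blast
    have "card (F e) \<le> card {u, v}" using e by (intro card_mono) (auto simp: F_def)
    also have "\<dots> \<le> 2" by (simp add: card_insert_if)
    finally show ?thesis by (simp add: f_def)
  qed
  moreover have "(\<Sum>e \<in> incident_edges G v. f e) \<le> 1" if v: "v \<in> ?V" for v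
  proof -
    have "{u \<in> ?V. {u, s u} \<in> incident_edges G v} \<subseteq> insert v {u \<in> ?V. s u = v}"
      by (auto simp: incident_edges_def)
    then have "card {u \<in> ?V. {u, s u} \<in> incident_edges G v} \<le> card (insert v {u \<in> ?V. s u = v})"
      using finV by (intro card_mono) auto
    also have "\<dots> \<le> Suc (card {u \<in> ?V. s u = v})" by (rule card_insert_le_m1) simp_all
    also have "card {u \<in> ?V. s u = v} \<le> 1"
      using inj finV by (subst One_nat_def, subst card_le_Suc0_iff_eq) (auto simp: inj_on_def)
    finally show ?thesis by (subst sum_F) (auto simp: incident_edges_def)
  qed
  moreover have "(\<Sum>e \<in> edges G. f e) = real (card ?V) / 2"
  proof -
    have "{u \<in> ?V. {u, s u} \<in> edges G} = ?V" using edge by blast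
    then show ?thesis using sum_F[of "edges G"] by simp
  qed
  ultimately have "fractional_perfect_matching G f"
    by (simp add: fractional_perfect_matching_def fractional_matching_def f_def)
  then show ?thesis by blast
qed

text \<open>The injection comes from Hall's theorem applied to the neighbourhoods; what needs proof
  is that expansion of independent sets already forces Hall's condition for every
  \<open>X\<close>.\<close>

lemma fractional_perfect_matching_if_independent_expansion:
  assumes "pair_graph G"
    and expand: "\<And>T. T \<subseteq> pverts G \<Longrightarrow> (\<And>u v. u \<in> T \<Longrightarrow> v \<in> T \<Longrightarrow> (u, v) \<notin> parcs G)
      \<Longrightarrow> card T \<le> card (parcs G `` T)"
  shows "\<exists>f. fractional_perfect_matching G f"
proof -
  interpret pair_graph G by fact
  have sym: "(u, v) \<in> parcs G \<longleftrightarrow> (v, u) \<in> parcs G" for u v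
    using pair_sym_arcs by (auto simp: symmetric_def sym_def)
  note finV = pair_finite_verts
  have finN: "finite (parcs G `` X)" for X
    using pair_finite_arcs by (rule finite_Image)
  have "card X \<le> card (\<Union>((\<lambda>v. parcs G `` {v}) ` X))" if X: "X \<subseteq> pverts G" for X
  proof -
    \<comment> \<open>Split off the vertices isolated in the subgraph induced by \<open>X\<close>: the others are neighbours
      of \<open>X\<close>, and the neighbours of the isolated ones lie outside \<open>X\<close>.\<close>
    define T where "T = X - parcs G `` X"
    have finX: "finite X" using X finV finite_subset by blast
    have "card X = card T + card (X \<inter> parcs G `` X)"
      using card_Int_Diff[OF finX, of "parcs G `` X"] by (simp add: T_def)
    also have "card T \<le> card (parcs G `` T)"
      using X by (intro expand) (auto simp: T_def)
    also have "card (parcs G `` T) + card (X \<inter> parcs G `` X)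
        = card (parcs G `` T \<union> (X \<inter> parcs G `` X))"
      using finX finN sym by (intro card_Un_disjoint[symmetric]) (auto simp: T_def)
    also have "\<dots> \<le> card (parcs G `` X)"
      using finN by (intro card_mono) (auto simp: T_def)
    also have "parcs G `` X = \<Union>((\<lambda>v. parcs G `` {v}) ` X)" by auto
    finally show ?thesis by simp
  qed
  then have "\<exists>s. inj_on s (pverts G) \<and> (\<forall>v \<in> pverts G. s v \<in> parcs G `` {v})"
    using finV finN by (intro Hall_marriage)
  then obtain s where "inj_on s (pverts G)" "\<And>v. v \<in> pverts G \<Longrightarrow> s v \<in> parcs G `` {v}" by blast
  then show ?thesis using assms(1) by (intro fractional_perfect_matching_if_injection[of _ s]) auto
qed

section \<open>The exceptional join\<close>

lemma isomorphic_refl: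
  assumes "pair_graph G"
  shows "isomorphic G G"
proof -
  interpret pair_graph G by fact
  have wf: "wf_digraph (with_proj G)" by unfold_locales
  show ?thesis
  unfolding isomorphic_def digraph_iso_def
  by (rule exI[of _ "\<lparr>iso_verts = id, iso_arcs = id, iso_head = snd, iso_tail = fst\<rparr>"])
    (use wf in \<open>simp add: pre_digraph.digraph_isomorphism_def app_iso_def with_proj_def\<close>)
qed

theorem theorem4p3:
  fixes G :: "'a pair_pre_digraph" and \<delta> :: nat
  assumes "pair_graph G"
    and "Digraph_Component.connected (with_proj G)"
    and "min_degree G = \<delta>"
    and "q1 (complement G) < 2 * real \<delta> + 1"
  shows "(\<exists>f. fractional_perfect_matching G f) \<or>
    (\<exists>H1 H2 :: 'a pair_pre_digraph.
       pair_graph H1 \<and> card (pverts H1) = \<delta> + 1 \<and> parcs H1 = {} \<and>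
       pair_graph H2 \<and> card (pverts H2) = \<delta> \<and>
       pverts H1 \<inter> pverts H2 = {} \<and>
       isomorphic G (join H1 H2))"
proof (subst disj_commute, rule disjCI)
  interpret pair_graph G by fact
  have sym: "(u, v) \<in> parcs G \<longleftrightarrow> (v, u) \<in> parcs G" for u v
    using pair_sym_arcs by (auto simp: symmetric_def sym_def)
  note finV = pair_finite_verts
  have finN: "finite (parcs G `` X)" for X
    using pair_finite_arcs by (rule finite_Image)
  have independent_le: "card T \<le> \<delta> + 1"
    if T: "T \<subseteq> pverts G" "\<And>u v. u \<in> T \<Longrightarrow> v \<in> T \<Longrightarrow> (u, v) \<notin> parcs G" for T
  proof (cases "T = {}")
    case False
    have "2 * (real (card T) - 1) \<le> q1 (complement G)"
      using T False assms(1)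
      by (intro q1_ge_clique pair_graph_complement) (auto simp: complement_def)
    \<comment> \<open>The two bounds give t < \<delta> + 3/2 for t = \<open>card T\<close>; the
      weaker t < \<delta> + 2 is enough because t is an integer.\<close>
    with assms(4) have "real (card T) < real (\<delta> + 2)" by simp
    then show ?thesis by linarith
  qed simp
  assume "\<not> (\<exists>f. fractional_perfect_matching G f)"
  then obtain T where T: "T \<subseteq> pverts G" "\<And>u v. u \<in> T \<Longrightarrow> v \<in> T \<Longrightarrow> (u, v) \<notin> parcs G"
    and less: "card (parcs G `` T) < card T"
    using fractional_perfect_matching_if_independent_expansion[OF assms(1)] by (meson not_le)
  let ?S = "parcs G `` T"
  have finT: "finite T" using T finV finite_subset by blast
  have deg: "\<delta> \<le> card (parcs G `` {v})" if "v \<in> T" for v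
  proof -
    have "\<delta> \<le> vertex_degree G v"
      unfolding assms(3)[symmetric] min_degree_def using that T finV by (intro Min_le) auto
    then show ?thesis by (simp add: vertex_degree_eq_card Image_singleton)
  qed
  have sub: "parcs G `` {v} \<subseteq> ?S" if "v \<in> T" for v using that by auto
  obtain t where t: "t \<in> T" using less by fastforce
  \<comment> \<open>The chain \<delta> \<le> \<open>card ?S\<close> < \<open>card T\<close> \<le>
    \<delta> + 1 leaves no slack.\<close>
  have "\<delta> \<le> card ?S" using deg[OF t] card_mono[OF finN sub[OF t]] by linarith
  with independent_le[OF T] less have cards: "card T = \<delta> + 1" "card ?S = \<delta>" by linarith+
  \<comment> \<open>A neighbourhood of at least \<delta> vertices inside the \<delta>-element set
    \<open>?S\<close> is all of it.\<close>
  have nbrs: "parcs G `` {v} = ?S" if "v \<in> T" for v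
    using that deg cards by (intro card_seteq finN sub) auto
  have "w \<in> T \<union> ?S" if w: "w \<in> pverts G" for w
  proof (rule ccontr)
    assume w': "w \<notin> T \<union> ?S"
    have "(w, w) \<notin> parcs G" using pair_no_loops by fastforce
    then have "card (insert w T) \<le> \<delta> + 1"
      using T w w' sym by (intro independent_le) auto
    with w' finT cards show False by simp
  qed
  then have V: "pverts G = T \<union> ?S" using T(1) wellformed' by blast
  \<comment> \<open>The subgraphs of \<open>G\<close> induced on the independent set
    \<open>T\<close> and on its neighbourhood. Their join is \<open>G\<close> itself, so reflexivity
    of isomorphism suffices.\<close>
  define H1 where "H1 = \<lparr>pverts = T, parcs = {}\<rparr>"
  define H2 where "H2 = \<lparr>pverts = ?S, parcs = parcs G \<inter> ?S \<times> ?S\<rparr>"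
  have "pair_graph H1"
    using finT by unfold_locales (auto simp: H1_def symmetric_def sym_def)
  moreover have "pair_graph H2"
    using finN pair_finite_arcs pair_no_loops sym
    by unfold_locales (auto simp: H2_def symmetric_def sym_def)
  moreover have "T \<inter> ?S = {}" using T by auto
  moreover have "join H1 H2 = G"
  proof (rule pair_pre_digraph.equality)
    show "pverts (join H1 H2) = pverts G" by (simp add: join_def H1_def H2_def V)
    have "T \<times> ?S \<subseteq> parcs G" using nbrs by blast
    moreover from this have "?S \<times> T \<subseteq> parcs G" using sym by blast
    moreover have "parcs G \<subseteq> (T \<union> ?S) \<times> (T \<union> ?S)" using wellformed' V by auto
    ultimately show "parcs (join H1 H2) = parcs G"
      using T(2) unfolding join_def H1_def H2_def by auto
  qed simp
  ultimately show "\<exists>H1 H2 :: 'a pair_pre_digraph.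
       pair_graph H1 \<and> card (pverts H1) = \<delta> + 1 \<and> parcs H1 = {} \<and>
       pair_graph H2 \<and> card (pverts H2) = \<delta> \<and>
       pverts H1 \<inter> pverts H2 = {} \<and>
       isomorphic G (join H1 H2)"
    using cards isomorphic_refl[OF assms(1)] by (intro exI[of _ H1] exI[of _ H2]) (simp add: H1_def H2_def)
qed

end
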